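(* Let $L$ be a bounded distributive lattice and let $f \colon L^n \to L$ be a polynomial function with at least two essential variables. Then $\operatorname{gap} f = 2$ if and only if there are elements $a, b \in L$ such that $a < b$ and \[ f \equiv (a \vee \operatorname{median}) \wedge b = a \vee (\operatorname{median} \wedge b), \] where $(a \vee \operatorname{median}) \wedge b$ denotes the ternary function $L^3 \to L$, $(x_1,x_2,x_3) \mapsto (a \vee \operatorname{median}(x_1,x_2,x_3)) \wedge b$, and similarly for $a \vee (\operatorname{median} \wedge b)$. Otherwise, $\operatorname{gap} f = 1$.
   Context: $L$ is an arbitrary (possibly infinite) bounded distributive lattice with operations $\wedge$, $\vee$, least element $0$, greatest element $1$, and associated order $\leqslant$. All functions have positive integer arity. Polynomial function: a map $f \colon L^n \to L$ which can be obtained by composition of the binary operations $\wedge$ and $\vee$, the projections, and the constant functions. Median: $\operatorname{median} \colon L^3 \to L$ is given by $\operatorname{median}(x_1,x_2,x_3) = (x_1 \wedge x_2) \vee (x_2 \wedge x_3) \vee (x_3 \wedge x_1)$. Essential variables: for sets $A, B$ and $f \colon A^n \to B$, the $i$-th variable $x_i$ is essential in $f$ if there are $a_1, \ldots, a_n, b \in A$ with $f(a_1, \ldots, a_{i-1}, a_i, a_{i+1}, \ldots, a_n) \neq f(a_1, \ldots, a_{i-1}, b, a_{i+1}, \ldots, a_n)$. The number of essential variables of $f$ is its essential arity, denoted $\operatorname{ess} f$. Simple minors and equivalence: $f \colon A^n \to B$ is a simple minor of $g \colon A^m \to B$, written $f \leq g$, if there is a mapping $\sigma \colon \{1,\ldots,m\}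 \to \{1,\ldots,n\}$ such that $f(x_1,\ldots,x_n) = g(x_{\sigma(1)}, \ldots, x_{\sigma(m)})$ for all $x_1,\ldots,x_n \in A$. The arities $n$ and $m$ may differ. Write $f \equiv g$ (equivalent) if $f \leq g$ and $g \leq f$, and $f < g$ if $f \leq g$ but $g \not\leq f$. Arity gap: for $f \colon A^n \to B$ with $\operatorname{ess} f \geq 2$, put $\operatorname{ess}^{<} f := \max_{g < f} \operatorname{ess} g$ (with $g$ ranging over $B$-valued functions on $A$ of any arity) and $\operatorname{gap} f := \operatorname{ess} f - \operatorname{ess}^{<} f$. Equivalently, $\operatorname{gap} f = \min_{i \neq j} (\operatorname{ess} f - \operatorname{ess} f_{i \gets j})$, where $i$ and $j$ range over the indices of essential variables of $f$ and $f_{i \gets j} \colon A^n \to B$ is defined by $f_{i \gets j}(x_1,\ldots,x_n) = f(x_1, \ldots, x_{i-1}, x_j, x_{i+1}, \ldots, x_n)$. For polynomial functions these notions are applied with $A = B = L$. *)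

theory Defs
  imports Main
begin

unbundle lattice_syntax

text \<open>
  An \<open>n\<close>-ary function \<open>A\<^sup>n \<rightarrow> B\<close> is represented by its arity \<open>n\<close> together with a function
  \<open>f :: 'a list \<Rightarrow> 'b\<close>, of which only the values on lists of length \<open>n\<close> matter: every notion
  below is invariant under changing \<open>f\<close> on lists of other lengths. Variables are indexed from 0.
\<close>

definition essential :: "nat \<Rightarrow> ('a list \<Rightarrow> 'b) \<Rightarrow> nat \<Rightarrow> bool" where
  "essential n f i \<longleftrightarrow> i < n \<and> (\<exists>xs b. length xs = n \<and> f xs \<noteq> f (xs[i := b]))"

definition ess :: "nat \<Rightarrow> ('a list \<Rightarrow> 'b) \<Rightarrow> nat" where
  "ess n f = card {i. essential n f i}"

text \<open>\<open>simple_minor n f m g\<close> is \<open>f \<le> g\<close> for \<open>f\<close> of arity \<open>n\<close> and \<open>g\<close> of arity \<open>m\<close>.\<close>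

definition simple_minor :: "nat \<Rightarrow> ('a list \<Rightarrow> 'b) \<Rightarrow> nat \<Rightarrow> ('a list \<Rightarrow> 'b) \<Rightarrow> bool" where
  "simple_minor n f m g \<longleftrightarrow>
    (\<exists>\<sigma>. (\<forall>i<m. \<sigma> i < n) \<and>
         (\<forall>xs. length xs = n \<longrightarrow> f xs = g (map (\<lambda>i. xs ! \<sigma> i) [0..<m])))"

definition minor_equiv :: "nat \<Rightarrow> ('a list \<Rightarrow> 'b) \<Rightarrow> nat \<Rightarrow> ('a list \<Rightarrow> 'b) \<Rightarrow> bool" where
  "minor_equiv n f m g \<longleftrightarrow> simple_minor n f m g \<and> simple_minor m g n f"

definition strict_minor :: "nat \<Rightarrow> ('a list \<Rightarrow> 'b) \<Rightarrow> nat \<Rightarrow> ('a list \<Rightarrow> 'b) \<Rightarrow> bool" where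
  "strict_minor n f m g \<longleftrightarrow> simple_minor n f m g \<and> \<not> simple_minor m g n f"

text \<open>
  The set below is finite, since a minor of \<open>f\<close> has at most \<open>ess n f\<close> essential variables, and
  nonempty if \<open>ess n f \<ge> 2\<close>; \<open>ess_less\<close> and \<open>gap\<close> are meaningful only in that case.
\<close>

definition ess_less :: "nat \<Rightarrow> ('a list \<Rightarrow> 'b) \<Rightarrow> nat" where
  "ess_less n f =
    Max {ess m g | (m :: nat) (g :: 'a list \<Rightarrow> 'b). m > 0 \<and> strict_minor m g n f}"

definition gap :: "nat \<Rightarrow> ('a list \<Rightarrow> 'b) \<Rightarrow> int" where
  "gap n f = int (ess n f) - int (ess_less n f)"

text \<open>
  The rule \<open>ext\<close> makes the predicate independent of the values of a representing function on lists
  whose length is not the arity.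
\<close>

inductive polynomial_function ::
  "nat \<Rightarrow> ('a::{distrib_lattice, bounded_lattice} list \<Rightarrow> 'a) \<Rightarrow> bool" where
  meet: "polynomial_function 2 (\<lambda>xs. xs ! 0 \<sqinter> xs ! 1)"
| join: "polynomial_function 2 (\<lambda>xs. xs ! 0 \<squnion> xs ! 1)"
| proj: "i < n \<Longrightarrow> polynomial_function n (\<lambda>xs. xs ! i)"
| const: "n > 0 \<Longrightarrow> polynomial_function n (\<lambda>xs. c)"
| comp: "polynomial_function m g \<Longrightarrow> (\<And>i. i < m \<Longrightarrow> polynomial_function n (h i)) \<Longrightarrow>
    polynomial_function n (\<lambda>xs. g (map (\<lambda>i. h i xs) [0..<m]))"
| ext: "polynomial_function n f \<Longrightarrow> (\<And>xs. length xs = n \<Longrightarrow> g xs = f xs) \<Longrightarrow>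
    polynomial_function n g"

definition median :: "'a::lattice \<Rightarrow> 'a \<Rightarrow> 'a \<Rightarrow> 'a" where
  "median x y z = (x \<sqinter> y) \<squnion> (y \<sqinter> z) \<squnion> (z \<sqinter> x)"

end

theory Submission
  imports Defs
begin

text \<open>
  A polynomial function is of the form \<open>p \<squnion> (x \<sqinter> q)\<close> with \<open>p \<le> q\<close> in each variable \<open>x\<close>, so it is
  determined by its values on the vertices of the cube, that is, by a monotone set function \<open>c\<close>.
  If \<open>gap f \<noteq> 1\<close>, then every identification of two essential variables \<open>i\<close>, \<open>j\<close> loses a third
  essential variable \<open>k\<close>, which means that \<open>c I < c (insert k I)\<close> only for sets \<open>I\<close> separating \<open>i\<close>
  and \<open>j\<close>. Fixing \<open>i\<close>, monotonicity makes the steps of \<open>c\<close> in direction \<open>k\<close> a subset of those in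
  direction \<open>j\<close>, up to an exchange of \<open>j\<close> and \<open>k\<close>. Following \<open>j \<mapsto> k\<close> down to a minimal set of
  steps yields a triple in which each variable is lost when the other two are identified.
  Such triples form a Steiner triple system on the essential variables, and the sets where \<open>c\<close>
  increases rule out any system with more than one triple. On a single triple, \<open>c\<close> is
  constant on the sets with at most one element and on those with at least two: it is the median,
  clipped to an interval \<open>[a, b]\<close>.
\<close>

section \<open>Losing variables of monotone set functions\<close>

text \<open>For monotone \<open>c\<close> the inequality \<open>\<noteq>\<close> amounts to
  \<open><\<close>; stated this way, no order on the values is required.\<close>

definition strict_step :: "('b set \<Rightarrow> 'c) \<Rightarrow> 'b set \<Rightarrow> 'b \<Rightarrow> bool" where
  "strict_step c I k \<longleftrightarrow> k \<notin> I \<and> c I \<noteq> c (insert k I)"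

text \<open>
  \<open>lost c i j k\<close>: the variable \<open>k\<close> becomes inessential when \<open>i\<close> and \<open>j\<close> are identified.
\<close>

definition lost :: "('b set \<Rightarrow> 'c) \<Rightarrow> 'b \<Rightarrow> 'b \<Rightarrow> 'b \<Rightarrow> bool" where
  "lost c i j k \<longleftrightarrow> i \<noteq> j \<and> k \<noteq> i \<and> k \<noteq> j \<and>
    (\<forall>I. strict_step c I k \<longrightarrow> (i \<in> I) \<noteq> (j \<in> I))"

lemma lost_sym: "lost c i j k \<Longrightarrow> lost c j i k"
  unfolding lost_def by blast

definition lost_triple :: "('b set \<Rightarrow> 'c) \<Rightarrow> 'b \<Rightarrow> 'b \<Rightarrow> 'b \<Rightarrow> bool" where
  "lost_triple c i j k \<longleftrightarrow> lost c i j k \<and> lost c j k i \<and> lost c i k j"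

lemma lost_triple_sym:
  assumes "lost_triple c i j k"
  shows "lost_triple c i k j" "lost_triple c j i k"
  using assms lost_sym unfolding lost_triple_def by metis+

text \<open>Moving \<open>j\<close> into \<open>I\<close>, or \<open>i\<close> out of it, puts both
  on the same side, so the step in direction \<open>k\<close> vanishes there. Hence c I < c (I+k) <=
  c (I+j+k) = c (I+j), and c (I-i+k) = c (I-i) <= c I < c (I+k). This exchange of directions drives
  the arguments below.\<close>

lemma lost_stepD:
  fixes c :: "'b set \<Rightarrow> 'c::order"
  assumes mono: "\<And>I k. c I \<le> c (insert k I)"
    and "lost c i j k" and "strict_step c I k" and "i \<in> I"
  shows "j \<notin> I" and "strict_step c I j" and "strict_step c (insert k (I - {i})) i"
proof -
  have d: "i \<noteq> j" "k \<noteq> i" "k \<noteq> j"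
    and sep: "\<And>J. k \<notin> J \<Longrightarrow> (i \<in> J) = (j \<in> J) \<Longrightarrow> c J = c (insert k J)"
    using assms(2) unfolding lost_def strict_step_def by blast+
  have k: "k \<notin> I" "c I \<noteq> c (insert k I)"
    using assms(3) unfolding strict_step_def by auto
  then have less: "c I < c (insert k I)"
    using mono by (simp add: order_less_le)
  show j: "j \<notin> I"
    using sep k assms(4) by blast
  have "c (insert j I) = c (insert k (insert j I))"
    using sep[of "insert j I"] k d assms(4) by blast
  then have "c I < c (insert j I)"
    using less mono[of "insert k I" j] by (simp add: insert_commute)
  then show "strict_step c I j"
    using j unfolding strict_step_def by auto
  have "c (insert k (I - {i})) = c (I - {i})"
    using sep[of "I - {i}"] k d j by simp
  also have "\<dots> \<le> c I"
    using mono[of "I - {i}" i] assms(4) by (simp add: insert_absorb)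
  finally have "c (insert k (I - {i})) < c (insert k I)"
    using less by order
  moreover have "insert i (insert k (I - {i})) = insert k I"
    using assms(4) by blast
  ultimately show "strict_step c (insert k (I - {i})) i"
    using d unfolding strict_step_def by auto
qed

text \<open>
  A step avoiding \<open>i\<close> is recorded by its upper end \<open>insert x I\<close>: with this choice the set of
  steps is literally decreasing along \<open>y \<mapsto> x\<close> in \<open>hub_steps_antimono\<close>.
\<close>

definition hub_steps :: "('b set \<Rightarrow> 'c) \<Rightarrow> 'b \<Rightarrow> 'b \<Rightarrow> ('b set \<times> bool) set" where
  "hub_steps c i x =
    {(I, True) | I. strict_step c I x \<and> i \<in> I} \<union>
    {(insert x I, False) | I. strict_step c I x \<and> i \<notin> I}"

lemma hub_steps_True: "(I, True) \<in> hub_steps c i x \<longleftrightarrow> strict_step c I x \<and> i \<in> I"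
  unfolding hub_steps_def by auto

lemma hub_steps_False:
  assumes "i \<noteq> x"
  shows "(K, False) \<in> hub_steps c i x \<longleftrightarrow> x \<in> K \<and> strict_step c (K - {x}) x \<and> i \<notin> K"
proof
  assume "(K, False) \<in> hub_steps c i x"
  then obtain I where "K = insert x I" "strict_step c I x" "i \<notin> I"
    unfolding hub_steps_def by auto
  then show "x \<in> K \<and> strict_step c (K - {x}) x \<and> i \<notin> K"
    using assms by (auto simp: strict_step_def)
next
  assume "x \<in> K \<and> strict_step c (K - {x}) x \<and> i \<notin> K"
  then show "(K, False) \<in> hub_steps c i x"
    unfolding hub_steps_def by (auto intro!: exI[of _ "K - {x}"])
qed

text \<open>If the step in direction \<open>x\<close> contains \<open>i\<close>, the same set is a
  step in direction \<open>y\<close>. If it avoids \<open>i\<close>, it contains \<open>y\<close>,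
  and the exchange with the roles of \<open>i\<close> and \<open>y\<close> swapped turns the step
  from K-x to K into one from K-y to K, with the same upper end.\<close>

lemma hub_steps_antimono:
  fixes c :: "'b set \<Rightarrow> 'c::order"
  assumes mono: "\<And>I k. c I \<le> c (insert k I)" and lost: "lost c i y x"
  shows "hub_steps c i x \<subseteq> hub_steps c i y"
proof -
  have d: "i \<noteq> x" "i \<noteq> y" "x \<noteq> y"
    using lost unfolding lost_def by auto
  have T: "(I, True) \<in> hub_steps c i y" if "(I, True) \<in> hub_steps c i x" for I
    using that lost_stepD[OF mono lost, of I] unfolding hub_steps_True by blast
  have F: "(K, False) \<in> hub_steps c i y" if "(K, False) \<in> hub_steps c i x" for K
  proof -
    have K: "x \<in> K" "strict_step c (K - {x}) x" "i \<notin> K"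
      using that d by (auto simp: hub_steps_False)
    then have "y \<in> K - {x}"
      using lost unfolding lost_def by blast
    moreover from this have "strict_step c (insert x (K - {x} - {y})) y"
      using lost_stepD(3)[OF mono lost_sym[OF lost] K(2)] by blast
    moreover have "insert x (K - {x} - {y}) = K - {y}"
      using K d by blast
    ultimately show ?thesis
      using K d by (simp add: hub_steps_False)
  qed
  show ?thesis
    using T F by (metis (full_types) subrelI)
qed

lemma lost_triple_if_hub_steps_eq:
  fixes c :: "'b set \<Rightarrow> 'c::order"
  assumes mono: "\<And>I k. c I \<le> c (insert k I)"
    and lost: "lost c i x y" and eq: "hub_steps c i x = hub_steps c i y"
    and z: "lost c x y z" and ex: "\<exists>I. strict_step c I z"
  shows "lost_triple c i x y"
proof -
  have d: "i \<noteq> x" "i \<noteq> y" "x \<noteq> y"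
    using lost unfolding lost_def by auto
  \<comment> \<open>A step shared by directions \<open>x\<close> and \<open>y\<close> decides where
    \<open>y\<close> lies: outside a common lower end, inside a common upper end.\<close>
  have "(i \<in> I) \<noteq> (y \<in> I)" if I: "strict_step c I x" for I
  proof (cases "i \<in> I")
    case True
    then have "strict_step c I y"
      using I eq by (metis hub_steps_True)
    then show ?thesis
      using True by (auto simp: strict_step_def)
  next
    case False
    have "x \<notin> I" using I by (simp add: strict_step_def)
    then have "(insert x I, False) \<in> hub_steps c i x"
      using I False d by (simp add: hub_steps_False)
    then show ?thesis
      using eq False d by (simp add: hub_steps_False)
  qed
  then have lost': "lost c i y x"
    using d unfolding lost_def by auto
  \<comment> \<open>If \<open>z\<close> differs from \<open>i\<close>, the exchange at
    \<open>J\<close> gives a step in direction \<open>y\<close>, which forces \<open>i\<close> out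
    of \<open>J\<close>, and then a step in direction \<open>x\<close> whose lower end contains
    neither \<open>i\<close> nor \<open>y\<close>.\<close>
  have no: False if "lost c x y z" "lost c i x y" "lost c i y x" "z \<noteq> i"
      "strict_step c J z" "x \<in> J" for x y J
  proof -
    have "strict_step c J y" and y: "y \<notin> J" and "strict_step c (insert z (J - {x})) x"
      using lost_stepD[OF mono that(1,5,6)] by auto
    then have "i \<notin> J" and "(i \<in> insert z (J - {x})) \<noteq> (y \<in> insert z (J - {x}))"
      using that unfolding lost_def by blast+
    then show False
      using that y unfolding lost_def by blast
  qed
  obtain J where J: "strict_step c J z" using ex by blast
  have "z = i"
  proof (rule ccontr)
    assume "z \<noteq> i"
    moreover have "x \<in> J \<or> y \<in> J"
      using z J unfolding lost_def by blast
    ultimately show False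
      using no[OF z lost lost' _ J] no[OF lost_sym[OF z] lost' lost _ J] by blast
  qed
  then show ?thesis
    using z lost lost' unfolding lost_triple_def by blast
qed

text \<open>Exchanges within the triple turn one step in direction \<open>x\<close> into a lower end
  that must avoid \<open>l\<close> and an upper end that must contain \<open>l\<close>. Only
  \<open>x\<close> and \<open>y\<close> can lie in the latter but not in the former.\<close>

lemma lost_triple_hub_stepsD:
  fixes c :: "'b set \<Rightarrow> 'c::order"
  assumes mono: "\<And>I k. c I \<le> c (insert k I)"
    and T: "lost_triple c i x y" and sub: "hub_steps c i x \<subseteq> hub_steps c i l"
    and ex: "\<exists>I. strict_step c I x" and "l \<noteq> i"
  shows "l \<in> {x, y}"
proof -
  have lost: "lost c i x y" "lost c x y i" "lost c i y x"
    using T unfolding lost_triple_def by auto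
  have d: "i \<noteq> x" "i \<noteq> y" "x \<noteq> y"
    using lost unfolding lost_def by auto
  have yx: "hub_steps c i y \<subseteq> hub_steps c i l"
    using hub_steps_antimono[OF mono lost(1)] sub by blast
  obtain I where I: "strict_step c I x" using ex by blast
  show ?thesis
  proof (cases "i \<in> I")
    case True
    have 1: "y \<notin> I" "strict_step c (insert x (I - {i})) i"
      using lost_stepD[OF mono lost(3) I True] by auto
    then have 2: "strict_step c (insert x (I - {i})) y"
      using lost_stepD[OF mono lost(2)] by blast
    have "(insert y (insert x (I - {i})), False) \<in> hub_steps c i y"
      unfolding hub_steps_def using 2 d by blast
    with yx have "(insert y (insert x (I - {i})), False) \<in> hub_steps c i l" ..
    then have "l \<in> insert y (insert x (I - {i}))"
      using hub_steps_False[of i l] assms(5) by metis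
    moreover have "(I, True) \<in> hub_steps c i l"
      using I True sub hub_steps_True by fast
    then have "l \<notin> I"
      by (simp add: hub_steps_True strict_step_def)
    ultimately show ?thesis by blast
  next
    case False
    have y: "y \<in> I"
      using lost(3) I False unfolding lost_def by blast
    then have i: "strict_step c I i"
      using lost_stepD[OF mono lost_sym[OF lost(3)] I] by blast
    have "strict_step c (insert i (I - {y})) y"
      using lost_stepD(3)[OF mono lost_sym[OF lost(2)] i y] .
    then have "(insert i (I - {y}), True) \<in> hub_steps c i y"
      by (simp add: hub_steps_True)
    with yx have "(insert i (I - {y}), True) \<in> hub_steps c i l" ..
    then have "l \<notin> I - {y}"
      by (simp add: hub_steps_True strict_step_def)
    moreover have "(insert x I, False) \<in> hub_steps c i l"
      using I False sub unfolding hub_steps_def by blast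
    then have "l \<in> insert x I"
      using hub_steps_False[of i l] assms(5) by metis
    ultimately show ?thesis by blast
  qed
qed

section \<open>The Steiner triple system of lost triples\<close>

lemma ex_lost_triple:
  fixes c :: "'b set \<Rightarrow> 'c::order"
  assumes "finite N" and mono: "\<And>I k. c I \<le> c (insert k I)"
    and step: "\<And>k. k \<in> N \<Longrightarrow> \<exists>I. strict_step c I k"
    and lost: "\<And>i j. i \<in> N \<Longrightarrow> j \<in> N \<Longrightarrow> i \<noteq> j \<Longrightarrow> \<exists>k\<in>N. lost c i j k"
    and "i \<in> N" "l \<in> N" "i \<noteq> l"
  shows "\<exists>y\<in>N. lost_triple c i l y"
proof -
  \<comment> \<open>The minimal set of steps is taken below that of \<open>l\<close>, since this
    inclusion later forces \<open>l\<close> into the triple found.\<close>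
  obtain x where x: "x \<in> N - {i}" "hub_steps c i x \<subseteq> hub_steps c i l"
    and min: "\<And>y. y \<in> N - {i} \<Longrightarrow> hub_steps c i y \<subseteq> hub_steps c i x \<Longrightarrow> hub_steps c i x = hub_steps c i y"
  proof -
    have "finite (hub_steps c i ` (N - {i}))" "hub_steps c i l \<in> hub_steps c i ` (N - {i})"
      using assms(1,6,7) by auto
    from finite_has_minimal2[OF this] obtain H where
      "H \<in> hub_steps c i ` (N - {i})" "H \<subseteq> hub_steps c i l"
      "\<forall>H'\<in>hub_steps c i ` (N - {i}). H' \<subseteq> H \<longrightarrow> H = H'" by blast
    moreover from this(1) obtain x where "x \<in> N - {i}" "H = hub_steps c i x" ..
    ultimately show ?thesis
      using that[of x] by simp
  qed
  obtain y where y: "y \<in> N" "lost c i x y"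
    using lost x assms(5) by blast
  moreover have "y \<noteq> i" "x \<noteq> y" using y unfolding lost_def by auto
  ultimately have eq: "hub_steps c i x = hub_steps c i y"
    using min hub_steps_antimono[OF mono y(2)] by blast
  obtain z where "z \<in> N" "lost c x y z"
    using lost[of x y] x y \<open>x \<noteq> y\<close> by blast
  then have T: "lost_triple c i x y"
    using lost_triple_if_hub_steps_eq[OF mono y(2) eq] step by blast
  have "l = x \<or> l = y"
    using lost_triple_hub_stepsD[OF mono T x(2)] step x assms(7) by blast
  then show ?thesis
    using T lost_triple_sym(1)[OF T] x y by blast
qed

text \<open>For a step in direction \<open>k\<close> containing \<open>i\<close>, the exchange
  yields steps in directions \<open>j\<close> and \<open>i\<close>. The first keeps \<open>l\<close>
  out of \<open>I\<close>; the second then has neither \<open>j\<close> nor \<open>l\<close> in its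
  lower end, although it must separate them.\<close>

lemma lost_triple_unique:
  fixes c :: "'b set \<Rightarrow> 'c::order"
  assumes mono: "\<And>I k. c I \<le> c (insert k I)"
    and T: "lost_triple c i j k" "lost_triple c i j l" and ex: "\<exists>I. strict_step c I k"
  shows "l = k"
proof (rule ccontr)
  assume "l \<noteq> k"
  have no: False if T: "lost_triple c i j k" "lost_triple c i j l"
    and I: "strict_step c I k" "i \<in> I" for i j I
  proof -
    have lost: "lost c i j k" "lost c i l j" "lost c j l i"
      using T unfolding lost_triple_def by auto
    have I': "j \<notin> I" "strict_step c I j" "strict_step c (insert k (I - {i})) i"
      using lost_stepD[OF mono lost(1) I] by auto
    then have "l \<notin> I"
      using lost(2) I unfolding lost_def by blast
    then show False
      using lost I' \<open>l \<noteq> k\<close> unfolding lost_def by blast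
  qed
  obtain I where I: "strict_step c I k" using ex by blast
  have "i \<in> I \<or> j \<in> I"
    using T I unfolding lost_triple_def lost_def by blast
  then show False
    using no[OF T I] no[OF lost_triple_sym(2)[OF T(1)] lost_triple_sym(2)[OF T(2)] I] by blast
qed

lemma lost_triple_exhausts:
  fixes c :: "'b set \<Rightarrow> 'c::order"
  assumes "finite N" and mono: "\<And>I k. c I \<le> c (insert k I)"
    and step: "\<And>k. k \<in> N \<Longrightarrow> \<exists>I. strict_step c I k"
    and lost: "\<And>i j. i \<in> N \<Longrightarrow> j \<in> N \<Longrightarrow> i \<noteq> j \<Longrightarrow> \<exists>k\<in>N. lost c i j k"
    and N: "i \<in> N" "j \<in> N" "k \<in> N" and T: "lost_triple c i j k"
  shows "N = {i, j, k}"
proof (rule ccontr)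
  assume "N \<noteq> {i, j, k}"
  then obtain l where l: "l \<in> N" "l \<notin> {i, j, k}" using N by blast
  note triple = ex_lost_triple[OF assms(1-4)]
  obtain l' where l': "l' \<in> N" "lost_triple c i l l'"
    using triple N l by blast
  have uniq: "b = b'" if "lost_triple c i' a b" "lost_triple c i' a b'" "b' \<in> N" for i' a b b'
    using lost_triple_unique[OF mono that(2,1) step[OF that(3)]] .
  \<comment> \<open>A step in direction \<open>i\<close> contains one further point of each triple
    through \<open>i\<close>. By symmetry these are \<open>j\<close> and \<open>l\<close>; the third
    point \<open>t\<close> of the triple on \<open>j\<close> and \<open>l\<close> can then lie
    neither inside nor outside \<open>I\<close>.\<close>
  have no: False if T: "lost_triple c i j k" "lost_triple c i l l'" and N: "j \<in> N" "k \<in> N" "l \<in> N"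
    and l: "l \<noteq> j" "l \<noteq> k" and I: "strict_step c I i" "j \<in> I" "l \<in> I" for j k l l' I
  proof -
    obtain t where t: "t \<in> N" "lost_triple c j l t"
      using triple N l by blast
    have "i \<notin> I" using I by (simp add: strict_step_def)
    have "t \<noteq> i"
      using uniq[OF T(1), of l] t lost_triple_sym N l by metis
    show False
    proof (cases "t \<in> I")
      case True
      \<comment> \<open>The exchange gives a step in direction \<open>j\<close> that contains both
        \<open>l\<close> and \<open>t\<close> instead of separating them.\<close>
      have "lost c j k i"
        using T(1) unfolding lost_triple_def by blast
      from lost_stepD(3)[OF mono this I(1,2)] have "strict_step c (insert i (I - {j})) j" .
      moreover have "lost c l t j"
        using t unfolding lost_triple_def by blast
      ultimately show False
        using True I unfolding lost_def by blast
    next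
      case False
      \<comment> \<open>The triple on \<open>i\<close> and \<open>t\<close> makes \<open>I\<close> a
        step in direction \<open>t\<close> as well, yet \<open>I\<close> contains both
        \<open>j\<close> and \<open>l\<close>.\<close>
      obtain s where s: "s \<in> N" "lost_triple c i t s"
        using triple \<open>i \<in> N\<close> t \<open>t \<noteq> i\<close> by blast
      then have "lost c s t i"
        by (simp add: lost_triple_def lost_sym)
      moreover from this have "s \<in> I"
        using I False unfolding lost_def by blast
      ultimately have "strict_step c I t"
        using lost_stepD(2)[OF mono _ I(1)] by blast
      then show False
        using t I unfolding lost_triple_def lost_def by blast
    qed
  qed
  have "l' \<noteq> j" "l' \<noteq> k"
    using uniq[OF T, of l] uniq[OF lost_triple_sym(1)[OF T], of l] l lost_triple_sym(1)[OF l'(2)]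
    by auto
  obtain I where I: "strict_step c I i" using step N by blast
  have "j \<in> I \<or> k \<in> I" "l \<in> I \<or> l' \<in> I"
    using I T l' unfolding lost_triple_def lost_def by blast+
  moreover note T' = lost_triple_sym(1)[OF T] lost_triple_sym(1)[OF l'(2)]
  have "\<not> (j \<in> I \<and> l \<in> I)" using no[OF T l'(2) N(2,3) l(1) _ _ I] l by blast
  moreover have "\<not> (k \<in> I \<and> l \<in> I)" using no[OF T'(1) l'(2) N(3,2) l(1) _ _ I] l by blast
  moreover have "\<not> (j \<in> I \<and> l' \<in> I)"
    using no[OF T T'(2) N(2,3) l'(1) _ _ I] \<open>l' \<noteq> j\<close> \<open>l' \<noteq> k\<close> by blast
  moreover have "\<not> (k \<in> I \<and> l' \<in> I)"
    using no[OF T'(1) T'(2) N(3,2) l'(1) _ _ I] \<open>l' \<noteq> j\<close> \<open>l' \<noteq> k\<close> by blast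
  ultimately show False by blast
qed

lemma ex_lost_triple_eq:
  fixes c :: "'b set \<Rightarrow> 'c::order"
  assumes "card N \<ge> 2" and mono: "\<And>I k. c I \<le> c (insert k I)"
    and step: "\<And>k. k \<in> N \<Longrightarrow> \<exists>I. strict_step c I k"
    and lost: "\<And>i j. i \<in> N \<Longrightarrow> j \<in> N \<Longrightarrow> i \<noteq> j \<Longrightarrow> \<exists>k\<in>N. lost c i j k"
  shows "\<exists>i j k. N = {i, j, k} \<and> lost_triple c i j k"
proof -
  have fin: "finite N" using assms(1) card.infinite by fastforce
  obtain i j where ij: "i \<in> N" "j \<in> N" "i \<noteq> j"
    using assms(1) by (metis card_le_Suc0_iff_eq fin not_less_eq_eq numeral_2_eq_2)
  then obtain k where "k \<in> N" "lost_triple c i j k"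
    using ex_lost_triple[OF fin mono step lost] by blast
  with ij lost_triple_exhausts[OF fin mono step lost] show ?thesis by blast
qed

section \<open>Minors and essential variables\<close>

abbreviation essentials :: "nat \<Rightarrow> ('a list \<Rightarrow> 'b) \<Rightarrow> nat set" where
  "essentials n f \<equiv> {i. essential n f i}"

lemma essentials_subset: "essentials n f \<subseteq> {..<n}"
  by (auto simp: essential_def)

lemma finite_essentials [simp]: "finite (essentials n f)"
  using essentials_subset finite_subset by blast

text \<open>Passes through the hybrids with the first \<open>j\<close> entries from
  \<open>ys\<close> and the others from \<open>xs\<close>.\<close>

lemma list_eq_stepwise:
  assumes len: "length xs = n" "length ys = n"
    and step: "\<And>zs j. length zs = n \<Longrightarrow> j < n \<Longrightarrow> zs ! j = xs ! j \<Longrightarrow> f (zs[j := ys ! j]) = f zs"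
  shows "f xs = f ys"
proof -
  have "j \<le> n \<Longrightarrow> f (take j ys @ drop j xs) = f xs" for j
  proof (induction j)
    case (Suc j)
    let ?zs = "take j ys @ drop j xs"
    have "take (Suc j) ys @ drop (Suc j) xs = ?zs[j := ys ! j]"
      using Suc.prems len by (auto intro!: nth_equalityI simp: nth_append nth_list_update min_def)
    also have "f \<dots> = f ?zs"
      using Suc.prems len by (intro step) (auto simp: nth_append)
    finally show ?case using Suc by simp
  qed simp
  from this[of n] show ?thesis using len by simp
qed

lemma eq_if_eq_on_essentials:
  assumes "length xs = n" "length ys = n" "\<And>i. essential n f i \<Longrightarrow> xs ! i = ys ! i"
  shows "f xs = f ys"
proof (rule list_eq_stepwise[OF assms(1,2)])
  fix zs j
  assume z: "length zs = n" "j < n" "zs ! j = xs ! j"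
  show "f (zs[j := ys ! j]) = f zs"
  proof (cases "essential n f j")
    case True
    then show ?thesis using z assms(3) by (metis list_update_id)
  next
    case False
    then show ?thesis using z unfolding essential_def by metis
  qed
qed

lemma essentials_minor:
  assumes "\<And>xs. length xs = m \<Longrightarrow> g xs = f (map (\<lambda>i. xs ! \<sigma> i) [0..<n])"
  shows "essentials m g \<subseteq> \<sigma> ` essentials n f"
proof clarify
  fix i assume "essential m g i"
  then obtain xs b where xs: "length xs = m" "g xs \<noteq> g (xs[i := b])"
    unfolding essential_def by blast
  then have "f (map (\<lambda>j. xs ! \<sigma> j) [0..<n]) \<noteq> f (map (\<lambda>j. xs[i := b] ! \<sigma> j) [0..<n])"
    using assms by simp
  then obtain j where "essential n f j"
    "map (\<lambda>j. xs ! \<sigma> j) [0..<n] ! j \<noteq> map (\<lambda>j. xs[i := b] ! \<sigma> j) [0..<n] ! j"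
    using eq_if_eq_on_essentials by (metis (no_types, lifting) length_map length_upt minus_nat.diff_0)
  moreover from this(1) have "j < n" by (simp add: essential_def)
  ultimately show "i \<in> \<sigma> ` essentials n f"
    by (cases "\<sigma> j = i") auto
qed

lemma ess_minor_le:
  assumes "simple_minor m g n f"
  shows "ess m g \<le> ess n f"
proof -
  obtain \<sigma> where "\<And>xs. length xs = m \<Longrightarrow> g xs = f (map (\<lambda>i. xs ! \<sigma> i) [0..<n])"
    using assms unfolding simple_minor_def by blast
  from essentials_minor[where g=g and f=f, OF this] have "card (essentials m g) \<le> card (\<sigma> ` essentials n f)"
    by (simp add: card_mono)
  also have "\<dots> \<le> card (essentials n f)"
    by (simp add: card_image_le)
  finally show ?thesis by (simp add: ess_def)
qed

text \<open>Equal counts make \<open>\<sigma>\<close> injective on the essential variables of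
  \<open>f\<close>, so it can be inverted there. Strictness of a minor thus becomes a matter of
  counting.\<close>

lemma simple_minor_if_ess_eq:
  assumes "simple_minor m g n f" "ess m g = ess n f" "n > 0"
  shows "simple_minor n f m g"
proof -
  obtain \<sigma> where \<sigma>: "\<And>i. i < n \<Longrightarrow> \<sigma> i < m"
    and g: "\<And>xs. length xs = m \<Longrightarrow> g xs = f (map (\<lambda>i. xs ! \<sigma> i) [0..<n])"
    using assms(1) unfolding simple_minor_def by blast
  have "card (essentials n f) \<le> card (\<sigma> ` essentials n f)"
    using card_mono[OF _ essentials_minor[where g=g and f=f and m=m, OF g]] assms(2) by (simp add: ess_def)
  then have inj: "inj_on \<sigma> (essentials n f)"
    by (simp add: card_image_le eq_card_imp_inj_on le_antisym)
  \<comment> \<open>The default 0 only has to be a legal index, whence \<open>n > 0\<close>: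
    essential variables of \<open>f\<close> never read it.\<close>
  define \<tau> where "\<tau> p = (if p \<in> \<sigma> ` essentials n f then inv_into (essentials n f) \<sigma> p else 0)" for p
  have "\<tau> p < n" for p
    using inv_into_into[of p \<sigma> "essentials n f"] assms(3) essentials_subset[of n f]
    unfolding \<tau>_def by auto
  moreover have "f xs = g (map (\<lambda>i. xs ! \<tau> i) [0..<m])" if "length xs = n" for xs
  proof -
    have "f xs = f (map (\<lambda>i. map (\<lambda>i. xs ! \<tau> i) [0..<m] ! \<sigma> i) [0..<n])"
    proof (rule eq_if_eq_on_essentials)
      fix i assume i: "essential n f i"
      then have "i < n" by (simp add: essential_def)
      moreover have "\<tau> (\<sigma> i) = i"
        using i inj by (simp add: \<tau>_def)
      ultimately show "xs ! i = map (\<lambda>i. map (\<lambda>i. xs ! \<tau> i) [0..<m] ! \<sigma> i) [0..<n] ! i"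
        using \<sigma> by simp
    qed (use that in auto)
    then show ?thesis by (simp add: g)
  qed
  ultimately show ?thesis unfolding simple_minor_def by blast
qed

lemma simple_minor_trans:
  fixes f :: "'a list \<Rightarrow> 'b"
  assumes "simple_minor l h m g" "simple_minor m g n f"
  shows "simple_minor l h n f"
proof -
  obtain \<sigma> where \<sigma>: "\<forall>i<m. \<sigma> i < l"
    "\<And>xs. length xs = l \<Longrightarrow> h xs = g (map (\<lambda>i. xs ! \<sigma> i) [0..<m])"
    using assms(1) unfolding simple_minor_def by blast
  obtain \<tau> where \<tau>: "\<forall>i<n. \<tau> i < m"
    "\<And>xs. length xs = m \<Longrightarrow> g xs = f (map (\<lambda>i. xs ! \<tau> i) [0..<n])"
    using assms(2) unfolding simple_minor_def by blast
  have "map (\<lambda>i. map (\<lambda>i. xs ! \<sigma> i) [0..<m] ! \<tau> i) [0..<n] = map (\<lambda>i. xs ! \<sigma> (\<tau> i)) [0..<n]" for xs :: "'a list"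
    using \<tau>(1) by simp
  then show ?thesis
    unfolding simple_minor_def using \<sigma> \<tau>
    by (intro exI[of _ "\<lambda>i. \<sigma> (\<tau> i)"]) (simp del: map_eq_conv)
qed

lemma strict_minor_ess_less:
  assumes "strict_minor m g n f" "n > 0"
  shows "ess m g < ess n f"
  using simple_minor_if_ess_eq[of m g n f] ess_minor_le[of m g n f] assms
  unfolding strict_minor_def by linarith

section \<open>Identification of variables and the maximum in \<open>ess_less\<close>\<close>

definition identify :: "nat \<Rightarrow> nat \<Rightarrow> ('a list \<Rightarrow> 'b) \<Rightarrow> 'a list \<Rightarrow> 'b" where
  "identify i j f = (\<lambda>xs. f (xs[i := xs ! j]))"

lemma identify_eq:
  assumes "i < n" "length xs = n"
  shows "identify i j f xs = f (map (\<lambda>p. xs ! (id(i := j)) p) [0..<n])"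
  unfolding identify_def using assms
  by (intro arg_cong[of _ _ f]) (auto intro!: nth_equalityI simp: nth_list_update)

lemma essentials_identify:
  assumes "i < n" "i \<noteq> j"
  shows "essentials n (identify i j f) \<subseteq> insert j (essentials n f - {i})"
proof -
  have "essentials n (identify i j f) \<subseteq> (id(i := j)) ` essentials n f"
    using assms by (intro essentials_minor identify_eq)
  also have "\<dots> \<subseteq> insert j (essentials n f - {i})" using assms by auto
  finally show ?thesis .
qed

lemma strict_minor_identify:
  assumes "essential n f i" "essential n f j" "i \<noteq> j"
  shows "strict_minor n (identify i j f) n f"
proof -
  have ij: "i < n" "j < n" using assms by (auto simp: essential_def)
  have "simple_minor n (identify i j f) n f"
    unfolding simple_minor_def using ij identify_eq[OF ij(1)]
    by (intro exI[of _ "id(i := j)"]) auto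
  moreover have "essentials n (identify i j f) \<subset> essentials n f"
    using essentials_identify[OF ij(1) assms(3), of f] assms by blast
  then have "ess n (identify i j f) < ess n f"
    unfolding ess_def by (simp add: psubset_card_mono)
  ultimately show ?thesis
    unfolding strict_minor_def using ess_minor_le by (metis not_le)
qed

lemma two_essentials:
  assumes "ess n f \<ge> 2"
  obtains i j where "essential n f i" "essential n f j" "i \<noteq> j"
proof -
  have "\<not> card (essentials n f) \<le> Suc 0" using assms by (simp add: ess_def)
  then show ?thesis using that by (auto simp: card_le_Suc0_iff_eq)
qed

lemma ess_less_props:
  fixes f :: "'a list \<Rightarrow> 'b"
  assumes "ess n f \<ge> 2"
  shows "\<exists>m>0. \<exists>g :: 'a list \<Rightarrow> 'b. strict_minor m g n f \<and> ess m g = ess_less n f"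
    and "\<And>m (g :: 'a list \<Rightarrow> 'b). m > 0 \<Longrightarrow> strict_minor m g n f \<Longrightarrow> ess m g \<le> ess_less n f"
    and "ess_less n f < ess n f"
proof -
  obtain i j where ij: "essential n f i" "essential n f j" "i \<noteq> j"
    using two_essentials assms .
  then have n: "n > 0" by (auto simp: essential_def)
  let ?S = "{ess m g | (m :: nat) (g :: 'a list \<Rightarrow> 'b). m > 0 \<and> strict_minor m g n f}"
  have "?S \<subseteq> {..<ess n f}" using strict_minor_ess_less n by blast
  then have fin: "finite ?S" using finite_subset by blast
  moreover have "?S \<noteq> {}" using strict_minor_identify[OF ij] n by blast
  ultimately have "ess_less n f \<in> ?S" unfolding ess_less_def by (rule Max_in)
  then show 1: "\<exists>m>0. \<exists>g :: 'a list \<Rightarrow> 'b. strict_minor m g n f \<and> ess m g = ess_less n f"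
    by (smt (verit) mem_Collect_eq)
  show "ess m g \<le> ess_less n f" if "m > 0" "strict_minor m g n f" for m and g :: "'a list \<Rightarrow> 'b"
    unfolding ess_less_def using fin that by (intro Max_ge) auto
  show "ess_less n f < ess n f" using 1 strict_minor_ess_less n by metis
qed

section \<open>Polynomial functions on the vertices of the cube\<close>

text \<open>A lattice form of Shannon expansion in each variable. Taking \<open>b\<close> to be
  \<open>\<top>\<close> shows that \<open>f\<close> does not decrease from \<open>\<bottom>\<close>
  to \<open>\<top>\<close>.\<close>

definition multiaffine :: "nat \<Rightarrow> ('a::bounded_lattice list \<Rightarrow> 'a) \<Rightarrow> bool" where
  "multiaffine n f \<longleftrightarrow> (\<forall>xs i b. length xs = n \<longrightarrow> i < n \<longrightarrow>
    f (xs[i := b]) = f (xs[i := \<bottom>]) \<squnion> (b \<sqinter> f (xs[i := \<top>])))"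

lemma multiaffineD:
  "multiaffine n f \<Longrightarrow> length xs = n \<Longrightarrow> i < n \<Longrightarrow>
    f (xs[i := b]) = f (xs[i := \<bottom>]) \<squnion> (b \<sqinter> f (xs[i := \<top>]))"
  unfolding multiaffine_def by blast

lemma multiaffine_bot_le_top:
  assumes "multiaffine n f" "length xs = n" "i < n"
  shows "f (xs[i := \<bottom>]) \<le> f (xs[i := \<top>])"
proof -
  have "f (xs[i := \<bottom>]) \<le> f (xs[i := \<bottom>]) \<squnion> (\<top> \<sqinter> f (xs[i := \<top>]))"
    by simp
  also have "\<dots> = f (xs[i := \<top>])"
    by (rule multiaffineD[OF assms, symmetric])
  finally show ?thesis .
qed

lemma multiaffine_const: "multiaffine n (\<lambda>xs. c)"
  by (simp add: multiaffine_def sup.absorb1)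

lemma multiaffine_nth: "i < n \<Longrightarrow> multiaffine n (\<lambda>xs. xs ! i)"
  by (auto simp: multiaffine_def nth_list_update sup.absorb1)

lemma multiaffine_sup:
  fixes f g :: "'a::{distrib_lattice, bounded_lattice} list \<Rightarrow> 'a"
  assumes "multiaffine n f" "multiaffine n g"
  shows "multiaffine n (\<lambda>xs. f xs \<squnion> g xs)"
  unfolding multiaffine_def
proof (intro allI impI)
  fix xs :: "'a list" and i b
  assume *: "length xs = n" "i < n"
  show "f (xs[i := b]) \<squnion> g (xs[i := b]) =
      f (xs[i := \<bottom>]) \<squnion> g (xs[i := \<bottom>]) \<squnion> b \<sqinter> (f (xs[i := \<top>]) \<squnion> g (xs[i := \<top>]))"
    unfolding multiaffineD[OF assms(1) *, of b] multiaffineD[OF assms(2) *, of b]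
    by (simp add: inf_sup_distrib1 ac_simps)
qed

text \<open>For \<open>p \<le> q\<close>, distributivity gives the dual form
  \<open>(p \<squnion> b) \<sqinter> q\<close>, which is compatible with meets.\<close>

lemma inf_multiaffine:
  fixes p q p' q' b :: "'a::distrib_lattice"
  assumes "p \<le> q" "p' \<le> q'"
  shows "(p \<squnion> (b \<sqinter> q)) \<sqinter> (p' \<squnion> (b \<sqinter> q')) = (p \<sqinter> p') \<squnion> (b \<sqinter> (q \<sqinter> q'))"
proof -
  have *: "p \<squnion> (b \<sqinter> q) = (p \<squnion> b) \<sqinter> q" "p' \<squnion> (b \<sqinter> q') = (p' \<squnion> b) \<sqinter> q'"
    using assms by (simp_all add: sup_inf_distrib1 sup.absorb2)
  have "p \<sqinter> p' \<le> q \<sqinter> q'" using assms by (rule inf_mono)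
  then have "(p \<sqinter> p') \<squnion> (b \<sqinter> (q \<sqinter> q')) = ((p \<sqinter> p') \<squnion> b) \<sqinter> (q \<sqinter> q')"
    by (simp add: sup_inf_distrib1 sup.absorb2)
  also have "\<dots> = (p \<squnion> b) \<sqinter> q \<sqinter> ((p' \<squnion> b) \<sqinter> q')"
    by (simp add: sup_inf_distrib1 sup_inf_distrib2 ac_simps)
  finally show ?thesis unfolding * by simp
qed

lemma multiaffine_inf:
  fixes f g :: "'a::{distrib_lattice, bounded_lattice} list \<Rightarrow> 'a"
  assumes "multiaffine n f" "multiaffine n g"
  shows "multiaffine n (\<lambda>xs. f xs \<sqinter> g xs)"
  unfolding multiaffine_def
proof (intro allI impI)
  fix xs :: "'a list" and i b
  assume *: "length xs = n" "i < n"
  show "f (xs[i := b]) \<sqinter> g (xs[i := b]) =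
      f (xs[i := \<bottom>]) \<sqinter> g (xs[i := \<bottom>]) \<squnion> b \<sqinter> (f (xs[i := \<top>]) \<sqinter> g (xs[i := \<top>]))"
    unfolding multiaffineD[OF assms(1) *, of b] multiaffineD[OF assms(2) *, of b]
    using multiaffine_bot_le_top[OF assms(1) *] multiaffine_bot_le_top[OF assms(2) *] by (rule inf_multiaffine)
qed

lemma multiaffine_update:
  assumes "multiaffine n f" "k < n"
  shows "multiaffine n (\<lambda>xs. f (xs[k := d]))"
  unfolding multiaffine_def
proof (intro allI impI)
  fix xs :: "'a list" and i b
  assume *: "length xs = n" "i < n"
  show "f (xs[i := b, k := d]) = f (xs[i := \<bottom>, k := d]) \<squnion> b \<sqinter> f (xs[i := \<top>, k := d])"
  proof (cases "i = k")
    case True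
    then show ?thesis by (simp add: sup.absorb1)
  next
    case False
    then show ?thesis
      using multiaffineD[OF assms(1), of "xs[k := d]" i b] * by (simp add: list_update_swap)
  qed
qed

lemma multiaffine_cong:
  fixes f g :: "'a::bounded_lattice list \<Rightarrow> 'a"
  assumes "multiaffine n f" "\<And>xs. length xs = n \<Longrightarrow> g xs = f xs"
  shows "multiaffine n g"
  unfolding multiaffine_def
proof (intro allI impI)
  fix xs :: "'a list" and i b
  assume *: "length xs = n" "i < n"
  show "g (xs[i := b]) = g (xs[i := \<bottom>]) \<squnion> b \<sqinter> g (xs[i := \<top>])"
    using multiaffineD[OF assms(1) *, of b] *(1) by (simp only: assms(2) length_list_update)
qed

text \<open>The inner functions are arbitrary so that the induction passes through composition;
  projections later recover the plain statement.\<close>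

lemma multiaffine_polynomial_comp:
  assumes "polynomial_function m g" "\<And>i. i < m \<Longrightarrow> multiaffine n (h i)"
  shows "multiaffine n (\<lambda>xs. g (map (\<lambda>i. h i xs) [0..<m]))"
  using assms
proof (induction arbitrary: h)
  case meet
  then show ?case by (simp add: multiaffine_inf)
next
  case join
  then show ?case by (simp add: multiaffine_sup)
next
  case (proj i m)
  then show ?case by simp
next
  case (const m c)
  show ?case by (rule multiaffine_const)
next
  case (comp k g m g')
  have "multiaffine n (\<lambda>xs. g (map (\<lambda>i. g' i (map (\<lambda>j. h j xs) [0..<m])) [0..<k]))"
    by (intro comp.IH(1) comp.IH(2)) (use comp.prems in auto)
  then show ?case .
next
  case (ext m f g)
  show ?case
    by (rule multiaffine_cong[OF ext.IH]) (use ext in auto)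
qed

lemma multiaffine_polynomial:
  assumes "polynomial_function n f"
  shows "multiaffine n f"
proof (rule multiaffine_cong)
  show "multiaffine n (\<lambda>xs. f (map (\<lambda>i. xs ! i) [0..<n]))"
    using multiaffine_polynomial_comp[OF assms multiaffine_nth] .
  show "f xs = f (map ((!) xs) [0..<n])" if "length xs = n" for xs
    using that map_nth by metis
qed

text \<open>The vertex of the cube given by the indicator of \<open>I\<close>. Elements of
  \<open>I\<close> beyond \<open>n\<close> are ignored, so \<open>f (chi n I)\<close> is a set
  function monotone under every insertion.\<close>

definition chi :: "nat \<Rightarrow> nat set \<Rightarrow> 'a::bounded_lattice list" where
  "chi n I = map (\<lambda>i. if i \<in> I then \<top> else \<bottom>) [0..<n]"

lemma length_chi [simp]: "length (chi n I) = n"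
  by (simp add: chi_def)

lemma nth_chi [simp]: "i < n \<Longrightarrow> chi n I ! i = (if i \<in> I then \<top> else \<bottom>)"
  by (simp add: chi_def)

lemma chi_update_top: "(chi n I)[k := \<top>] = chi n (insert k I)"
proof (rule nth_equalityI)
  fix i assume "i < length ((chi n I)[k := \<top>])"
  then show "(chi n I)[k := \<top>] ! i = chi n (insert k I) ! i"
    by (cases "i = k") simp_all
qed simp

lemma chi_update_bot: "(chi n I)[k := \<bottom>] = chi n (I - {k})"
proof (rule nth_equalityI)
  fix i assume "i < length ((chi n I)[k := \<bottom>])"
  then show "(chi n I)[k := \<bottom>] ! i = chi n (I - {k}) ! i"
    by (cases "i = k") simp_all
qed simp

lemma multiaffine_mono_chi:
  assumes "multiaffine n f"
  shows "f (chi n I) \<le> f (chi n (insert k I))"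
proof (cases "k < n \<and> k \<notin> I")
  case True
  then have "I - {k} = I" and k: "k < n" by auto
  have "f ((chi n I)[k := \<bottom>]) \<le> f ((chi n I)[k := \<top>])"
    using k by (intro multiaffine_bot_le_top[OF assms]) auto
  then show ?thesis
    by (simp only: chi_update_top chi_update_bot \<open>I - {k} = I\<close>)
next
  case False
  then have "chi n (insert k I) = (chi n I :: 'a list)"
    by (intro nth_equalityI) auto
  then show ?thesis by simp
qed

lemma multiaffine_eqI:
  assumes f: "multiaffine n f" and g: "multiaffine n g" and eq: "\<And>I. f (chi n I) = g (chi n I)"
    and "length xs = n"
  shows "f xs = g xs"
proof -
  \<comment> \<open>Induction on the number \<open>j\<close> of leading coordinates not yet known to
    be \<open>\<bottom>\<close> or \<open>\<top>\<close>.\<close>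
  have "j \<le> n \<Longrightarrow> length xs = n \<Longrightarrow> (\<forall>i. j \<le> i \<longrightarrow> i < n \<longrightarrow> xs ! i \<in> {\<bottom>, \<top>}) \<Longrightarrow> f xs = g xs" for j xs
  proof (induction j arbitrary: xs)
    case 0
    then have "xs = chi n {i. i < n \<and> xs ! i = \<top>}"
      by (intro nth_equalityI) auto
    then show ?case using eq by metis
  next
    case (Suc j)
    have "f (xs[j := d]) = g (xs[j := d])" if "d \<in> {\<bottom>, \<top>}" for d
      using Suc.prems that by (intro Suc.IH) (auto simp: nth_list_update)
    then have "f (xs[j := xs ! j]) = g (xs[j := xs ! j])"
      using multiaffineD[OF f, of xs j "xs ! j"] multiaffineD[OF g, of xs j "xs ! j"] Suc.prems by simp
    then show ?case by simp
  qed
  from this[of n] show ?thesis using assms(4) by simp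
qed

text \<open>Without a step in direction \<open>k\<close>, the two restrictions of \<open>f\<close>
  at \<open>k\<close> agree on vertices, hence everywhere, and the expansion in \<open>k\<close>
  collapses to a constant.\<close>

lemma essential_strict_step:
  assumes f: "multiaffine n f" and "essential n f k"
  shows "\<exists>I. strict_step (\<lambda>I. f (chi n I)) I k"
proof (rule ccontr)
  assume "\<nexists>I. strict_step (\<lambda>I. f (chi n I)) I k"
  then have no: "f (chi n I) = f (chi n (insert k I))" if "k \<notin> I" for I
    using that unfolding strict_step_def by blast
  obtain xs b where k: "k < n" and xs: "length xs = n" "f xs \<noteq> f (xs[k := b])"
    using assms(2) unfolding essential_def by blast
  have "f (xs[k := \<bottom>]) = f (xs[k := \<top>])"
  proof (rule multiaffine_eqI[OF multiaffine_update[OF f k] multiaffine_update[OF f k] _ xs(1)])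
    fix I
    show "f ((chi n I)[k := \<bottom>]) = f ((chi n I)[k := \<top>])"
      using no[of "I - {k}"] by (simp add: chi_update_bot chi_update_top)
  qed
  then have "f (xs[k := d]) = f (xs[k := \<top>])" for d
    using multiaffineD[OF f xs(1) k, of d] by (simp add: sup.absorb1)
  then show False using xs by (metis list_update_id)
qed

lemma lost_identify:
  assumes f: "multiaffine n f" and ess: "essential n f i" "essential n f j" "i \<noteq> j" and "k \<noteq> i" "k < n"
    and not: "\<not> essential n (identify i j f) k"
  shows "lost (\<lambda>I. f (chi n I)) i j k"
proof -
  have ij: "i < n" "j < n" using ess by (auto simp: essential_def)
  have inv: "f (xs[i := xs ! j]) = f (xs[k := b, i := xs[k := b] ! j])" if "length xs = n" for xs b
    using not that \<open>k < n\<close> unfolding essential_def identify_def by blast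
  \<comment> \<open>If \<open>j\<close> vanished together with \<open>i\<close>, emptying and
    filling both positions would give the same value; monotonicity then excludes every step in
    direction \<open>i\<close>.\<close>
  have "k \<noteq> j"
  proof
    assume "k = j"
    have eq: "f (chi n (I - {i, j})) = f (chi n (insert i (insert j I)))" for I
    proof -
      have sets: "I - {i, j} - {i} = I - {i, j}"
        "insert i (insert j (I - {i, j})) = insert i (insert j I)"
        by blast+
      have "f ((chi n (I - {i, j}))[i := \<bottom>]) = f ((chi n (I - {i, j}))[j := \<top>, i := \<top>])"
        using inv[of "chi n (I - {i, j})" \<top>] ij ess(3) \<open>k = j\<close> by simp
      then show ?thesis
        unfolding chi_update_top chi_update_bot sets .
    qed
    obtain I where I: "i \<notin> I" "f (chi n I) \<noteq> f (chi n (insert i I))"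
      using essential_strict_step[OF f ess(1)] unfolding strict_step_def by blast
    have "I - {i, j} = I \<or> insert j (I - {i, j}) = I"
      using I(1) by blast
    then have "f (chi n (I - {i, j})) \<le> f (chi n I)"
      using multiaffine_mono_chi[OF f, of "I - {i, j}" j] by (metis order_refl)
    moreover have "f (chi n I) \<le> f (chi n (insert i I))"
      by (rule multiaffine_mono_chi[OF f])
    moreover have "f (chi n (insert i I)) \<le> f (chi n (insert i (insert j I)))"
      using multiaffine_mono_chi[OF f, of "insert i I" j] by (simp add: insert_commute)
    ultimately have "f (chi n I) = f (chi n (insert i I))"
      using eq[of I] by order
    then show False using I by blast
  qed
  moreover have "(i \<in> I) \<noteq> (j \<in> I)" if "strict_step (\<lambda>I. f (chi n I)) I k" for I
  proof
    assume eq: "(i \<in> I) = (j \<in> I)"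
    \<comment> \<open>Vertices with \<open>i\<close> and \<open>j\<close> on the same side are fixed
      by the identification, so a step there would keep \<open>k\<close> essential.\<close>
    have "(chi n J)[i := chi n J ! j] = (chi n J :: 'a list)" if "(i \<in> J) = (j \<in> J)" for J
      using ij that by (auto intro!: nth_equalityI simp: nth_list_update)
    from this[of I] this[of "insert k I"] show False
      using inv[of "chi n I" \<top>] that eq \<open>k \<noteq> i\<close> \<open>k \<noteq> j\<close>
      by (simp add: strict_step_def chi_update_top)
  qed
  ultimately show ?thesis using assms unfolding lost_def by blast
qed

section \<open>The arity gap of polynomial functions\<close>

text \<open>The gap is always positive, so here each identification costs at least two essential
  variables: besides \<open>i\<close>, another one disappears.\<close>

lemma lost_triple_if_gap_neq_1:
  fixes f :: "'a::{distrib_lattice, bounded_lattice} list \<Rightarrow> 'a"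
  assumes f: "multiaffine n f" and ess2: "ess n f \<ge> 2" and gap: "gap n f \<noteq> 1"
  shows "\<exists>i j k. essentials n f = {i, j, k} \<and> lost_triple (\<lambda>I. f (chi n I)) i j k"
proof (rule ex_lost_triple_eq)
  show "card (essentials n f) \<ge> 2" using ess2 by (simp add: ess_def)
  show "f (chi n I) \<le> f (chi n (insert k I))" for I k
    using f by (rule multiaffine_mono_chi)
  show "\<exists>I. strict_step (\<lambda>I. f (chi n I)) I k" if "k \<in> essentials n f" for k
    using essential_strict_step[OF f] that by blast
  fix i j assume "i \<in> essentials n f" "j \<in> essentials n f" and "i \<noteq> j"
  then have i: "essential n f i" and j: "essential n f j" by auto
  then have n: "i < n" by (simp add: essential_def)
  let ?g = "identify i j f"
  have "ess n ?g \<le> ess_less n f"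
    using ess_less_props(2)[OF ess2] strict_minor_identify[OF i j \<open>i \<noteq> j\<close>] n by simp
  then have "ess n ?g < ess n f - 1"
    using ess_less_props(3)[OF ess2] gap unfolding gap_def by linarith
  also have "ess n f - 1 = card (essentials n f - {i})"
    using i by (simp add: ess_def)
  finally have "card (essentials n ?g) < card (essentials n f - {i})"
    by (simp add: ess_def)
  then have "\<not> essentials n f - {i} \<subseteq> essentials n ?g"
    using card_mono[OF finite_essentials] by (metis not_less)
  then obtain k where k: "essential n f k" "k \<noteq> i" "\<not> essential n ?g k"
    by blast
  then have "k < n" by (simp add: essential_def)
  then show "\<exists>k\<in>essentials n f. lost (\<lambda>I. f (chi n I)) i j k"
    using lost_identify[OF f i j \<open>i \<noteq> j\<close> k(2) _ k(3)] k(1) by blast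
qed

lemma eq_median_if_lost_triple:
  fixes f :: "'a::{distrib_lattice, bounded_lattice} list \<Rightarrow> 'a"
  assumes f: "multiaffine n f" and N: "essentials n f = {i, j, k}"
    and T: "lost_triple (\<lambda>I. f (chi n I)) i j k"
  shows "\<exists>a b. a < b \<and>
    (\<forall>xs. length xs = n \<longrightarrow> f xs = (a \<squnion> median (xs ! i) (xs ! j) (xs ! k)) \<sqinter> b)"
proof -
  define c where "c I = f (chi n I)" for I
  define a where "a = c {}"
  define b where "b = c {i, j, k}"
  have lt: "i < n" "j < n" "k < n" using N essentials_subset[of n f] by auto
  have d: "i \<noteq> j" "j \<noteq> k" "i \<noteq> k"
    using T unfolding lost_triple_def lost_def by auto
  have lost: "lost c i j k" "lost c j k i" "lost c i k j"
    using T unfolding lost_triple_def c_def by auto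
  have stepD: "c I = c (insert z I)"
    if "lost c x y z" "z \<notin> I" "(x \<in> I) = (y \<in> I)" for x y z I
    using that unfolding lost_def strict_step_def by blast
  \<comment> \<open>Neither identified variable lies in the empty set, and both lie in each pair
    below, so adding the third changes nothing.\<close>
  have one: "c {i} = a" "c {j} = a" "c {k} = a"
    using stepD[OF lost(1), of "{}"] stepD[OF lost(2), of "{}"] stepD[OF lost(3), of "{}"]
    by (simp_all add: a_def)
  have two: "c {i, j} = b" "c {j, k} = b" "c {i, k} = b"
    using stepD[OF lost(1), of "{i, j}"] stepD[OF lost(2), of "{j, k}"] stepD[OF lost(3), of "{i, k}"] d
    by (simp_all add: b_def insert_commute)
  have restrict: "c I = c (I \<inter> {i, j, k})" for I
    unfolding c_def
  proof (rule eq_if_eq_on_essentials[where n = n])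
    fix p assume p: "essential n f p"
    then have "p \<in> {i, j, k}" using N by blast
    moreover have "p < n" using p by (simp add: essential_def)
    ultimately show "chi n I ! p = chi n (I \<inter> {i, j, k}) ! p" by simp
  qed simp_all
  have c: "c I = (if i \<in> I \<and> j \<in> I \<or> j \<in> I \<and> k \<in> I \<or> i \<in> I \<and> k \<in> I then b else a)" for I
    using one two restrict[of I]
    by (cases "i \<in> I"; cases "j \<in> I"; cases "k \<in> I") (simp_all add: a_def b_def)
  have "a \<noteq> b"
  proof
    assume "a = b"
    then have "\<not> strict_step c I i" for I by (simp add: strict_step_def c)
    moreover have "\<exists>I. strict_step c I i"
      using essential_strict_step[OF f, of i] N unfolding c_def by blast
    ultimately show False by blast
  qed
  moreover have "a \<le> b"
    using multiaffine_mono_chi[OF f, of "{k}" j] one two unfolding c_def by metis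
  ultimately have "a < b" by simp
  have "f xs = (a \<squnion> median (xs ! i) (xs ! j) (xs ! k)) \<sqinter> b" if "length xs = n" for xs
    using f _ _ that
  proof (rule multiaffine_eqI)
    show "multiaffine n (\<lambda>xs. (a \<squnion> median (xs ! i) (xs ! j) (xs ! k)) \<sqinter> b)"
      unfolding median_def by (intro multiaffine_inf multiaffine_sup multiaffine_const multiaffine_nth lt)
    fix I
    have "f (chi n I) = c I" by (simp add: c_def)
    also have "\<dots> = (a \<squnion> median (chi n I ! i) (chi n I ! j) (chi n I ! k)) \<sqinter> b"
      unfolding c using lt \<open>a \<le> b\<close> by (simp add: median_def inf.absorb1)
    finally show "f (chi n I) = (a \<squnion> median (chi n I ! i) (chi n I ! j) (chi n I ! k)) \<sqinter> b" .
  qed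
  then show ?thesis using \<open>a < b\<close> by blast
qed

lemma minor_equiv_median:
  assumes lt: "i < n" "j < n" "k < n" and d: "i \<noteq> j" "j \<noteq> k" "i \<noteq> k"
    and f: "\<And>xs. length xs = n \<Longrightarrow> f xs = (a \<squnion> median (xs ! i) (xs ! j) (xs ! k)) \<sqinter> b"
  shows "minor_equiv n f 3 (\<lambda>xs. (a \<squnion> median (xs ! 0) (xs ! 1) (xs ! 2)) \<sqinter> b)"
  unfolding minor_equiv_def simple_minor_def
proof
  let ?\<sigma> = "\<lambda>p::nat. if p = 0 then i else if p = 1 then j else k"
  show "\<exists>\<sigma>. (\<forall>i<3. \<sigma> i < n) \<and> (\<forall>xs. length xs = n \<longrightarrow>
      f xs = (a \<squnion> median (map (\<lambda>i. xs ! \<sigma> i) [0..<3] ! 0) (map (\<lambda>i. xs ! \<sigma> i) [0..<3] ! 1)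
        (map (\<lambda>i. xs ! \<sigma> i) [0..<3] ! 2)) \<sqinter> b)"
    using lt f by (intro exI[of _ ?\<sigma>]) simp
  \<comment> \<open>Positions other than \<open>i\<close>, \<open>j\<close>, \<open>k\<close> are
    also sent to 2, harmlessly, as \<open>f\<close> does not read them.\<close>
  let ?\<tau> = "\<lambda>p::nat. if p = i then 0 else if p = j then 1 else 2 :: nat"
  show "\<exists>\<sigma>. (\<forall>i<n. \<sigma> i < 3) \<and> (\<forall>xs. length xs = 3 \<longrightarrow>
      (a \<squnion> median (xs ! 0) (xs ! 1) (xs ! 2)) \<sqinter> b = f (map (\<lambda>i. xs ! \<sigma> i) [0..<n]))"
    using lt d f by (intro exI[of _ ?\<tau>]) simp
qed

text \<open>Of three essential variables an identification keeps at least one, since the values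
  \<open>a\<close> and \<open>b\<close> on the constant vertices survive. So the gap is at most
  2.\<close>

lemma gap_eq_2_if_lost_triple:
  fixes f :: "'a::{distrib_lattice, bounded_lattice} list \<Rightarrow> 'a"
  assumes f: "multiaffine n f" and ess2: "ess n f \<ge> 2" and gap: "gap n f \<noteq> 1"
    and N: "essentials n f = {i, j, k}" and T: "lost_triple (\<lambda>I. f (chi n I)) i j k"
  shows "gap n f = 2"
proof -
  have d: "i \<noteq> j" "j \<noteq> k" "i \<noteq> k"
    using T unfolding lost_triple_def lost_def by auto
  have ess: "essential n f i" "essential n f j" using N by auto
  then have lt: "i < n" "j < n" by (auto simp: essential_def)
  have ess3: "ess n f = 3" using N d by (simp add: ess_def)
  let ?g = "identify i j f"
  obtain a b where ab: "a < b"
    "\<And>xs. length xs = n \<Longrightarrow> f xs = (a \<squnion> median (xs ! i) (xs ! j) (xs ! k)) \<sqinter> b"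
    using eq_median_if_lost_triple[OF f N T] by blast
  have "k < n" using N by (auto simp: essential_def)
  then have "?g (chi n {}) \<noteq> ?g (chi n UNIV)"
    using ab lt d by (simp add: identify_def median_def inf.absorb1 inf.absorb2 nth_list_update)
  then have "essentials n ?g \<noteq> {}"
    using eq_if_eq_on_essentials[of "chi n {}" n "chi n UNIV" ?g] by auto
  then have "ess n ?g \<ge> 1"
    by (simp add: ess_def Suc_le_eq card_gt_0_iff)
  moreover have "ess n ?g \<le> ess_less n f"
    using ess_less_props(2)[OF ess2] strict_minor_identify[OF ess d(1)] lt by simp
  ultimately show ?thesis
    using ess_less_props(3)[OF ess2] gap ess3 unfolding gap_def by linarith
qed

section \<open>Strict minors of the clipped median\<close>

lemma ess_median:
  fixes a b :: "'a::{distrib_lattice, bounded_lattice}"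
  assumes "a < b"
  shows "ess 3 (\<lambda>xs. (a \<squnion> median (xs ! 0) (xs ! 1) (xs ! 2)) \<sqinter> b) = 3"
proof -
  let ?h = "\<lambda>xs. (a \<squnion> median (xs ! 0) (xs ! 1) (xs ! 2)) \<sqinter> b"
  have ne: "?h [\<bottom>, \<top>, \<bottom>] \<noteq> ?h [\<top>, \<top>, \<bottom>]" "?h [\<top>, \<bottom>, \<bottom>] \<noteq> ?h [\<top>, \<top>, \<bottom>]"
    "?h [\<top>, \<bottom>, \<bottom>] \<noteq> ?h [\<top>, \<bottom>, \<top>]"
    using assms by (simp_all add: median_def inf.absorb1)
  have "essential 3 ?h 0" "essential 3 ?h 1" "essential 3 ?h 2"
    unfolding essential_def
    by (intro conjI, simp, intro exI[of _ "[\<bottom>, \<top>, \<bottom>]"] exI[of _ \<top>], use ne in simp)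
      (intro conjI, simp, intro exI[of _ "[\<top>, \<bottom>, \<bottom>]"] exI[of _ \<top>], use ne in simp)+
  then have "{..<3} \<subseteq> essentials 3 ?h"
    by (auto simp: less_Suc_eq numeral_3_eq_3 numeral_2_eq_2)
  then have "essentials 3 ?h = {..<3}"
    using essentials_subset[of 3 ?h] by blast
  then show ?thesis by (simp add: ess_def)
qed

text \<open>An injective \<open>\<sigma>\<close> would give an equivalent function. Otherwise two
  arguments of the median coincide, and it returns their common value.\<close>

lemma strict_minor_median:
  fixes a b :: "'a::{distrib_lattice, bounded_lattice}"
  assumes "strict_minor m g 3 (\<lambda>xs. (a \<squnion> median (xs ! 0) (xs ! 1) (xs ! 2)) \<sqinter> b)"
  shows "ess m g \<le> 1"
proof -
  let ?h = "\<lambda>xs :: 'a list. (a \<squnion> median (xs ! 0) (xs ! 1) (xs ! 2)) \<sqinter> b"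
  obtain \<sigma> where \<sigma>: "\<forall>i<3. \<sigma> i < m"
    and g: "\<And>xs. length xs = m \<Longrightarrow> g xs = ?h (map (\<lambda>i. xs ! \<sigma> i) [0..<3])"
    using assms unfolding strict_minor_def simple_minor_def by blast
  have g': "g xs = (a \<squnion> median (xs ! \<sigma> 0) (xs ! \<sigma> 1) (xs ! \<sigma> 2)) \<sqinter> b" if "length xs = m" for xs
    using g[OF that] by (simp add: numeral_2_eq_2)
  have lt: "\<sigma> 0 < m" "\<sigma> 1 < m" "\<sigma> 2 < m" using \<sigma> by auto
  have "\<not> (\<sigma> 0 \<noteq> \<sigma> 1 \<and> \<sigma> 1 \<noteq> \<sigma> 2 \<and> \<sigma> 0 \<noteq> \<sigma> 2)"
    using minor_equiv_median[OF lt _ _ _ g'] assms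
    unfolding minor_equiv_def strict_minor_def by blast
  then obtain s where s: "s < m"
    "\<And>xs :: 'a list. median (xs ! \<sigma> 0) (xs ! \<sigma> 1) (xs ! \<sigma> 2) = xs ! s"
  proof -
    have "median x x y = x" "median x y x = x" "median y x x = x" for x y :: 'a
      by (simp_all add: median_def sup.absorb1 sup.absorb2 inf.coboundedI1 inf.coboundedI2)
    then show ?thesis
      using that lt \<open>\<not> (\<sigma> 0 \<noteq> \<sigma> 1 \<and> \<sigma> 1 \<noteq> \<sigma> 2 \<and> \<sigma> 0 \<noteq> \<sigma> 2)\<close> by metis
  qed
  have "essentials m g \<subseteq> {s}"
  proof clarify
    fix i assume "essential m g i"
    then obtain xs b' where "length xs = m" "g xs \<noteq> g (xs[i := b'])"
      unfolding essential_def by blast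
    then show "i = s" using g' s by (cases "i = s") auto
  qed
  then show ?thesis
    unfolding ess_def using card_mono[of "{s}"] by fastforce
qed

text \<open>Strict minors of \<open>f\<close> are strict minors of the clipped median, so
  \<open>ess_less n f\<close> is at most 1, while \<open>ess n f\<close> is at least 3.\<close>

lemma gap_neq_1_if_minor_equiv_median:
  fixes f :: "'a::{distrib_lattice, bounded_lattice} list \<Rightarrow> 'a"
  assumes ess2: "ess n f \<ge> 2" and "a < b"
    and equiv: "minor_equiv n f 3 (\<lambda>xs. (a \<squnion> median (xs ! 0) (xs ! 1) (xs ! 2)) \<sqinter> b)"
  shows "gap n f \<noteq> 1"
proof -
  let ?h = "\<lambda>xs :: 'a list. (a \<squnion> median (xs ! 0) (xs ! 1) (xs ! 2)) \<sqinter> b"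
  have "ess n f \<ge> 3"
    using equiv ess_minor_le[of 3 ?h n f] ess_median[OF \<open>a < b\<close>] unfolding minor_equiv_def by simp
  obtain m and g :: "'a list \<Rightarrow> 'a" where g: "strict_minor m g n f" "ess m g = ess_less n f"
    using ess_less_props(1)[OF ess2] by blast
  have "simple_minor m g 3 ?h" "\<not> simple_minor 3 ?h m g"
    using g(1) equiv simple_minor_trans unfolding strict_minor_def minor_equiv_def by blast+
  then have "strict_minor m g 3 ?h"
    by (simp add: strict_minor_def)
  from strict_minor_median[OF this] show ?thesis
    using g(2) \<open>ess n f \<ge> 3\<close> unfolding gap_def by linarith
qed

theorem theorem6:
  fixes n :: nat and f :: "'a::{distrib_lattice, bounded_lattice} list \<Rightarrow> 'a"
  assumes "polynomial_function n f" and "ess n f \<ge> 2"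
  shows "(gap n f = 2 \<longleftrightarrow>
      (\<exists>a b :: 'a. a < b \<and>
        minor_equiv n f 3 (\<lambda>xs. (a \<squnion> median (xs ! 0) (xs ! 1) (xs ! 2)) \<sqinter> b) \<and>
        (\<forall>x y z. (a \<squnion> median x y z) \<sqinter> b = a \<squnion> (median x y z \<sqinter> b))))
    \<and> (gap n f \<noteq> 2 \<longrightarrow> gap n f = 1)"
proof -
  have f: "multiaffine n f" using assms(1) by (rule multiaffine_polynomial)
  \<comment> \<open>Assuming only that the gap is not 1 also delivers the dichotomy between 1 and
    2.\<close>
  have forward: "gap n f = 2 \<and> (\<exists>a b :: 'a. a < b \<and>
      minor_equiv n f 3 (\<lambda>xs. (a \<squnion> median (xs ! 0) (xs ! 1) (xs ! 2)) \<sqinter> b))"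
    if gap: "gap n f \<noteq> 1"
  proof -
    obtain i j k where N: "essentials n f = {i, j, k}"
      and T: "lost_triple (\<lambda>I. f (chi n I)) i j k"
      using lost_triple_if_gap_neq_1[OF f assms(2) gap] by blast
    obtain a b where "a < b" and
      eq: "\<And>xs. length xs = n \<Longrightarrow> f xs = (a \<squnion> median (xs ! i) (xs ! j) (xs ! k)) \<sqinter> b"
      using eq_median_if_lost_triple[OF f N T] by blast
    have "i < n" "j < n" "k < n" using N essentials_subset[of n f] by auto
    moreover have "i \<noteq> j" "j \<noteq> k" "i \<noteq> k"
      using T unfolding lost_triple_def lost_def by auto
    ultimately have "minor_equiv n f 3 (\<lambda>xs. (a \<squnion> median (xs ! 0) (xs ! 1) (xs ! 2)) \<sqinter> b)"
      using eq by (rule minor_equiv_median)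
    then show ?thesis
      using gap_eq_2_if_lost_triple[OF f assms(2) gap N T] \<open>a < b\<close> by blast
  qed
  have modular: "(a \<squnion> x) \<sqinter> b = a \<squnion> (x \<sqinter> b)" if "a < b" for a b x :: 'a
    using that by (simp add: inf_sup_distrib2 inf.absorb1)
  show ?thesis
    using forward modular gap_neq_1_if_minor_equiv_median[OF assms(2)]
    by (smt (verit))
qed

end
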